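(* Consider the downlink interference cancellation scheme (defined in the context) for the two-user broadcast channel with $N\ge 2$ transmit antennas and two antennas at each receiver. For each user $k\in\{1,2\}$ let the receiver form $$\bar r_1^{(k)}=r_{11}^{(k)}+r_{22}^{(k)*},\qquad \bar r_2^{(k)}=r_{12}^{(k)}-r_{21}^{(k)*}.$$ Then: (i) the signals of the other user $\underline{k}$ are zero-forced, i.e. neither $\bar r_1^{(k)}$ nor $\bar r_2^{(k)}$ contains any contribution from $s_1^{(\underline{k})}$ or $s_2^{(\underline{k})}$; (ii) the symbols $s_1^{(k)}$ and $s_2^{(k)}$ are decoupled, i.e. for each $l\in\{1,2\}$ the noise-free part of $\bar r_l^{(k)}$ is of the form $\gamma s_l^{(k)}$ with a scalar $\gamma$ depending only on $P$ and the channel coefficients, so it contains no contribution from the user's other symbol.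
   Context: Notation: for a complex scalar, $^*$ is complex conjugation; for a matrix or vector, $^*$ is the Hermitian (conjugate) transpose; $\|\cdot\|$ is the Frobenius norm. For $k\in\{1,2\}$, $\underline{k}$ denotes the element of $\{1,2\}$ other than $k$. Channels: $h_{ij}^{(k)}\in\mathbb{C}$ ($1\le i\le N$, $j,k\in\{1,2\}$) is the coefficient from transmit antenna $i$ to receive antenna $j$ of user $k$. It is constant over the two time slots and known at the transmitter but not at the receivers. The coefficients are i.i.d. $\mathcal{CN}(0,1)$, and we consider realizations for which all denominators below are nonzero (this holds almost surely). Let $\mathbf{h}_i^{(k)}=[h_{i1}^{(k)}\ h_{i2}^{(k)}]$ (a $1\times 2$ row vector) and $$\tilde{\mathbf{H}}_i^{(k)}=\begin{bmatrix}h_{i1}^{(k)}&h_{i2}^{(k)}\\-h_{i2}^{(k)*}&h_{i1}^{(k)*}\end{bmatrix},\qquad \tilde{\mathbf{H}}^{(k)}=\begin{bmatrix}\tilde{\mathbf{H}}_1^{(k)}\\ \vdots\\ \tilde{\mathbf{H}}_N^{(k)}\end{bmatrix}\in\mathbb{C}^{2N\times 2}.$$ Let $\tilde{\mathbf{B}}^{(k)}\in\mathbb{C}^{2(N-1)\times 2N}$ be the block matrix with $N-1$ block rows and $N$ block columns of size $2\times2$ whose block $(i,i)$ is $\tilde{\mathbf{H}}_i^{(k)*}/\|\mathbf{h}_i^{(k)}\|^2$ for $1\le i\le N-1$, whose block $(i,N)$ is $-\tilde{\mathbf{H}}_N^{(k)*}/\|\mathbf{h}_N^{(k)}\|^2$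 for $1\le i\le N-1$, and whose other blocks are zero. User separating precoder: $\bar{\mathbf{B}}^{(k)}\in\mathbb{C}^{2(N-1)\times N}$ is the block matrix with $2\times 1$ blocks whose block $(i,i)$ is $\mathbf{h}_i^{(k)*}/\|\mathbf{h}_i^{(k)}\|^2$, whose block $(i,N)$ is $-\mathbf{h}_N^{(k)*}/\|\mathbf{h}_N^{(k)}\|^2$ ($1\le i\le N-1$), and whose other blocks are zero. Symbol separating precoder: $$\mathbf{E}^{(k)}=\beta^{(k)}\big(\tilde{\mathbf{B}}^{(\underline{k})}\tilde{\mathbf{H}}^{(k)}\big)^*\in\mathbb{C}^{2\times 2(N-1)},\qquad \beta^{(k)}=\frac{\sqrt2}{\|\tilde{\mathbf{H}}^{(k)*}\tilde{\mathbf{B}}^{(\underline{k})*}\tilde{\mathbf{B}}^{(\underline{k})}\|}.$$ Transmission: let $s_1^{(k)},s_2^{(k)}\in\mathbb{C}$ be the two symbols intended for user $k$, let $P>0$ be the power, and let $$\tilde{\mathbf{X}}^{(k)}=\begin{bmatrix}s_1^{(k)}&s_2^{(k)}\\-s_2^{(k)*}&s_1^{(k)*}\end{bmatrix}\mathbf{E}^{(k)},\qquad \mathbf{X}=\sqrt{\tfrac P2}\left(\tilde{\mathbf{X}}^{(1)}\bar{\mathbf{B}}^{(2)}+\tilde{\mathbf{X}}^{(2)}\bar{\mathbf{B}}^{(1)}\right)\in\mathbb{C}^{2\times N}.$$ The entry $x_{ti}$ of $\mathbf{X}$ is sent from antenna $i$ in time slot $t\in\{1,2\}$. Antenna $j$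 of user $k$ receives, in slot $t$, $$r_{tj}^{(k)}=\sum_{i=1}^N x_{ti}h_{ij}^{(k)}+w_{tj}^{(k)},$$ where the $w_{tj}^{(k)}$ are i.i.d. $\mathcal{CN}(0,1)$ noise. The "noise-free part" of a received quantity is what remains when all $w_{tj}^{(k)}$ are set to $0$. *)

theory Defs
  imports "Jordan_Normal_Form.Schur_Decomposition"
begin

(* The Hermitian transpose is mat_adjoint.  Users, antennas, time slots and symbols are numbered
   from 1, whereas the library indexes matrix entries from 0.
   h k i j is the coefficient from transmit antenna i to receive antenna j of user k;
   s k l is the l-th symbol for user k; w k t j is the noise at antenna j of user k in slot t. *)

type_synonym channel = "nat \<Rightarrow> nat \<Rightarrow> nat \<Rightarrow> complex"
type_synonym symbols = "nat \<Rightarrow> nat \<Rightarrow> complex"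
type_synonym noise = "nat \<Rightarrow> nat \<Rightarrow> nat \<Rightarrow> complex"

definition frob :: "complex mat \<Rightarrow> real" where
  "frob A = sqrt (\<Sum>i<dim_row A. \<Sum>j<dim_col A. (cmod (A $$ (i, j)))\<^sup>2)"

(* p by q blocks of size m by n; block positions (i, j) are numbered from 1 *)
definition block_mat :: "nat \<Rightarrow> nat \<Rightarrow> nat \<Rightarrow> nat \<Rightarrow> (nat \<Rightarrow> nat \<Rightarrow> complex mat) \<Rightarrow> complex mat" where
  "block_mat p q m n A =
     mat (p * m) (q * n) (\<lambda>(a, b). A (a div m + 1) (b div n + 1) $$ (a mod m, b mod n))"

definition other :: "nat \<Rightarrow> nat" where
  "other k = 3 - k"

definition alamouti :: "complex \<Rightarrow> complex \<Rightarrow> complex mat" where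
  "alamouti a b = mat_of_rows_list 2 [[a, b], [- cnj b, cnj a]]"

definition h_row :: "channel \<Rightarrow> nat \<Rightarrow> nat \<Rightarrow> complex mat" where
  "h_row h k i = mat_of_rows_list 2 [[h k i 1, h k i 2]]"

definition H_tilde_block :: "channel \<Rightarrow> nat \<Rightarrow> nat \<Rightarrow> complex mat" where
  "H_tilde_block h k i = alamouti (h k i 1) (h k i 2)"

definition H_tilde :: "nat \<Rightarrow> channel \<Rightarrow> nat \<Rightarrow> complex mat" where
  "H_tilde N h k = block_mat N 1 2 2 (\<lambda>i j. H_tilde_block h k i)"

definition B_tilde :: "nat \<Rightarrow> channel \<Rightarrow> nat \<Rightarrow> complex mat" where
  "B_tilde N h k = block_mat (N - 1) N 2 2 (\<lambda>i j.
     if j = i then complex_of_real (1 / (frob (h_row h k i))\<^sup>2) \<cdot>\<^sub>m mat_adjoint (H_tilde_block h k i)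
     else if j = N then
       - (complex_of_real (1 / (frob (h_row h k N))\<^sup>2) \<cdot>\<^sub>m mat_adjoint (H_tilde_block h k N))
     else 0\<^sub>m 2 2)"

definition B_bar :: "nat \<Rightarrow> channel \<Rightarrow> nat \<Rightarrow> complex mat" where
  "B_bar N h k = block_mat (N - 1) N 2 1 (\<lambda>i j.
     if j = i then complex_of_real (1 / (frob (h_row h k i))\<^sup>2) \<cdot>\<^sub>m mat_adjoint (h_row h k i)
     else if j = N then
       - (complex_of_real (1 / (frob (h_row h k N))\<^sup>2) \<cdot>\<^sub>m mat_adjoint (h_row h k N))
     else 0\<^sub>m 2 1)"

definition beta_denom :: "nat \<Rightarrow> channel \<Rightarrow> nat \<Rightarrow> real" where
  "beta_denom N h k =
     frob (mat_adjoint (H_tilde N h k) * mat_adjoint (B_tilde N h (other k)) * B_tilde N h (other k))"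

definition beta :: "nat \<Rightarrow> channel \<Rightarrow> nat \<Rightarrow> real" where
  "beta N h k = sqrt 2 / beta_denom N h k"

definition E_prec :: "nat \<Rightarrow> channel \<Rightarrow> nat \<Rightarrow> complex mat" where
  "E_prec N h k =
     complex_of_real (beta N h k) \<cdot>\<^sub>m mat_adjoint (B_tilde N h (other k) * H_tilde N h k)"

definition admissible_channel :: "nat \<Rightarrow> channel \<Rightarrow> bool" where
  "admissible_channel N h \<longleftrightarrow>
     (\<forall>k\<in>{1, 2}. (\<forall>i\<in>{1..N}. frob (h_row h k i) \<noteq> 0) \<and> beta_denom N h k \<noteq> 0)"

definition X_tilde :: "nat \<Rightarrow> channel \<Rightarrow> symbols \<Rightarrow> nat \<Rightarrow> complex mat" where
  "X_tilde N h s k = alamouti (s k 1) (s k 2) * E_prec N h k"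

definition X_sent :: "nat \<Rightarrow> real \<Rightarrow> channel \<Rightarrow> symbols \<Rightarrow> complex mat" where
  "X_sent N P h s = complex_of_real (sqrt (P / 2)) \<cdot>\<^sub>m
     (X_tilde N h s 1 * B_bar N h 2 + X_tilde N h s 2 * B_bar N h 1)"

definition received ::
  "nat \<Rightarrow> real \<Rightarrow> channel \<Rightarrow> symbols \<Rightarrow> noise \<Rightarrow> nat \<Rightarrow> nat \<Rightarrow> nat \<Rightarrow> complex" where
  "received N P h s w k t j =
     (\<Sum>i = 1..N. X_sent N P h s $$ (t - 1, i - 1) * h k i j) + w k t j"

(* used only for l = 1 and l = 2 *)
definition r_bar ::
  "nat \<Rightarrow> real \<Rightarrow> channel \<Rightarrow> symbols \<Rightarrow> noise \<Rightarrow> nat \<Rightarrow> nat \<Rightarrow> complex" where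
  "r_bar N P h s w k l =
     (if l = 1 then received N P h s w k 1 1 + cnj (received N P h s w k 2 2)
      else received N P h s w k 1 2 - cnj (received N P h s w k 2 1))"

end

theory Submission
  imports Defs
begin

text \<open>
  Alamouti matrices form a real algebra closed under the adjoint. The receiver's map
  \<open>R \<mapsto> (R 1 1 + cnj (R 2 2), R 1 2 - cnj (R 2 1))\<close> is, up to a factor 2, the projection of a
  two by two matrix onto this algebra, and it commutes with left multiplication by Alamouti
  matrices. For the interfering user, each block of the transmitted signal multiplies a
  difference of two orthogonal projectors of rank one; such a difference is Hermitian with trace
  zero, so it projects to zero. For the user's own signal, block \<open>i\<close> projects to
  \<open>S * adjoint D * D\<close>, where \<open>D\<close> is the \<open>i\<close>-th Alamouti block of \<open>B_tilde * H_tilde\<close>, and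
  \<open>adjoint D * D\<close> is a scalar matrix.
\<close>

section \<open>Entries of adjoints and of block products\<close>

lemma dim_mat_adjoint [simp]:
  "dim_row (mat_adjoint A) = dim_col A" "dim_col (mat_adjoint A) = dim_row A"
  by (auto simp: mat_adjoint_def)

lemma index_mat_adjoint:
  fixes A :: "complex mat"
  assumes "i < dim_col A" "j < dim_row A"
  shows "mat_adjoint A $$ (i, j) = cnj (A $$ (j, i))"
  using assms by (simp add: mat_adjoint_def mat_of_rows_index)

lemma lessThan_2: "{..<2} = {0, 1::nat}"
  by auto

lemma sum_blocks:
  fixes f :: "nat \<Rightarrow> 'a::comm_monoid_add"
  shows "(\<Sum>a<p * m. f a) = (\<Sum>i<p. \<Sum>c<m. f (i * m + c))"
proof -
  have "(\<Sum>a<p * m. f a) = (\<Sum>i<p. sum f {i * m..<i * m + m})"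
    by (simp add: sum.nat_group)
  also have "\<dots> = (\<Sum>i<p. \<Sum>c<m. f (i * m + c))"
    using sum.shift_bounds_nat_ivl [of f 0 "_ * m" m]
    by (simp add: add.commute atLeast0LessThan)
  finally show ?thesis .
qed

lemma block_index_less:
  fixes i p c m :: nat
  assumes "i < p" "c < m"
  shows "i * m + c < p * m"
proof -
  have "i * m + c < (i + 1) * m" using assms by simp
  also have "\<dots> \<le> p * m" using assms by (intro mult_right_mono) auto
  finally show ?thesis .
qed

lemma dim_block_mat [simp]:
  "dim_row (block_mat p q m n A) = p * m" "dim_col (block_mat p q m n A) = q * n"
  by (simp_all add: block_mat_def)

lemma index_block_mat:
  assumes "i < p" "j < q" "c < m" "d < n"
  shows "block_mat p q m n A $$ (i * m + c, j * n + d) = A (i + 1) (j + 1) $$ (c, d)"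
  using assms by (simp add: block_mat_def block_index_less)

lemma index_block_mat_mult:
  assumes "i < p" "j < r" "c < m" "d < l"
  shows "(block_mat p q m n A * block_mat q r n l B) $$ (i * m + c, j * l + d) =
    (\<Sum>k<q. \<Sum>e<n. A (i + 1) (k + 1) $$ (c, e) * B (k + 1) (j + 1) $$ (e, d))"
  using assms
  by (simp add: scalar_prod_def block_index_less atLeast0LessThan sum_blocks index_block_mat)

lemma dim_alamouti [simp]: "dim_row (alamouti a b) = 2" "dim_col (alamouti a b) = 2"
  by (simp_all add: alamouti_def mat_of_rows_list_def)

lemma index_alamouti [simp]:
  "alamouti a b $$ (0, 0) = a" "alamouti a b $$ (0, Suc 0) = b"
  "alamouti a b $$ (Suc 0, 0) = - cnj b" "alamouti a b $$ (Suc 0, Suc 0) = cnj a"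
  by (simp_all add: alamouti_def mat_of_rows_list_def)

lemma dim_h_row [simp]: "dim_row (h_row h k i) = 1" "dim_col (h_row h k i) = 2"
  by (simp_all add: h_row_def mat_of_rows_list_def)

lemma index_h_row: "d < 2 \<Longrightarrow> h_row h k i $$ (0, d) = h k i (d + 1)"
  by (auto simp: h_row_def mat_of_rows_list_def numeral_2_eq_2 less_Suc_eq)

section \<open>Couplings of the channels through the precoders\<close>

definition inv_gain :: "channel \<Rightarrow> nat \<Rightarrow> nat \<Rightarrow> complex" where
  "inv_gain h k i = complex_of_real (1 / (frob (h_row h k i))\<^sup>2)"

text \<open>The bracket is the squared norm of the channel row. Written with products of conjugates,
  it can be used in \<open>eff_same_user\<close> by plain ring rewriting.\<close>

lemma inv_gain_mult:
  assumes "frob (h_row h k i) \<noteq> 0"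
  shows "inv_gain h k i * (cnj (h k i 1) * h k i 1 + cnj (h k i 2) * h k i 2) = 1"
proof -
  have "(frob (h_row h k i))\<^sup>2 = (cmod (h k i 1))\<^sup>2 + (cmod (h k i 2))\<^sup>2"
    by (simp add: frob_def lessThan_2 index_h_row numeral_2_eq_2)
  moreover have "cnj (h k i 1) * h k i 1 + cnj (h k i 2) * h k i 2 =
      complex_of_real ((cmod (h k i 1))\<^sup>2 + (cmod (h k i 2))\<^sup>2)"
    by (simp only: of_real_add complex_norm_square mult.commute)
  ultimately have "cnj (h k i 1) * h k i 1 + cnj (h k i 2) * h k i 2 =
      complex_of_real ((frob (h_row h k i))\<^sup>2)"
    by (simp only:)
  then show ?thesis
    unfolding inv_gain_def using assms by simp
qed

text \<open>Models a block row of \<open>B_bar\<close> or \<open>B_tilde\<close>, which has just two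
  nonzero blocks. The bound on \<open>i\<close> keeps the two positions distinct.\<close>

lemma sum_pivot_last:
  fixes f :: "nat \<Rightarrow> complex"
  assumes "i < N - 1"
  shows "(\<Sum>b<N. (if b = i then x else if b = N - 1 then y else 0) * f b) = x * f i + y * f (N - 1)"
proof -
  have "(\<Sum>b<N. (if b = i then x else if b = N - 1 then y else 0) * f b) =
      (\<Sum>b\<in>{i, N - 1}. (if b = i then x else if b = N - 1 then y else 0) * f b)"
    by (rule sum.mono_neutral_right) (use assms in auto)
  also have "\<dots> = x * f i + y * f (N - 1)"
    using assms by simp
  finally show ?thesis .
qed

lemma index_B_bar:
  assumes "i < N - 1" "d < 2" "b < N"
  shows "B_bar N h k $$ (i * 2 + d, b) =
    (if b = i then inv_gain h k (i + 1) * cnj (h k (i + 1) (d + 1))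
     else if b = N - 1 then - (inv_gain h k N * cnj (h k N (d + 1))) else 0)"
proof -
  \<comment> \<open>The column is written as block and offset, the shape
    \<open>index_block_mat\<close> expects.\<close>
  have "B_bar N h k $$ (i * 2 + d, b * 1 + 0) =
    (if b = i then inv_gain h k (i + 1) * cnj (h k (i + 1) (d + 1))
     else if b = N - 1 then - (inv_gain h k N * cnj (h k N (d + 1))) else 0)"
    unfolding B_bar_def using assms
    by (subst index_block_mat) (auto simp: index_mat_adjoint index_h_row inv_gain_def)
  then show ?thesis by simp
qed

text \<open>Entry (\<open>d\<close>, \<open>j\<close>) of a 2 by 2 matrix: antennas \<open>i\<close>
  and \<open>N\<close>, precoded for user \<open>v\<close> and heard by user \<open>u\<close>. For
  \<open>v = u\<close> and nonzero rows it is the difference of projectors.\<close>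

definition coupling :: "nat \<Rightarrow> channel \<Rightarrow> nat \<Rightarrow> nat \<Rightarrow> nat \<Rightarrow> nat \<Rightarrow> nat \<Rightarrow> complex" where
  "coupling N h v u i d j =
    inv_gain h v i * cnj (h v i d) * h u i j - inv_gain h v N * cnj (h v N d) * h u N j"

text \<open>Row \<open>i * 2 + d\<close> of \<open>B_bar\<close> reaches only antennas
  \<open>i + 1\<close> and \<open>N\<close>, so the sum over antennas collapses to one coupling
  entry.\<close>

lemma sum_mult_B_bar:
  assumes "dim_col Y = dim_row (B_bar N h v)" "t < dim_row Y"
  shows "(\<Sum>b<N. (Y * B_bar N h v) $$ (t, b) * h u (b + 1) j) =
    (\<Sum>i<N - 1. \<Sum>d<2. Y $$ (t, i * 2 + d) * coupling N h v u (i + 1) (d + 1) j)"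
proof -
  have dims: "dim_row (B_bar N h v) = (N - 1) * 2" "dim_col (B_bar N h v) = N"
    by (simp_all add: B_bar_def)
  have "(\<Sum>b<N. (Y * B_bar N h v) $$ (t, b) * h u (b + 1) j) =
      (\<Sum>b<N. \<Sum>i<N - 1. \<Sum>d<2. Y $$ (t, i * 2 + d) * B_bar N h v $$ (i * 2 + d, b) * h u (b + 1) j)"
  proof (rule sum.cong)
    fix b assume "b \<in> {..<N}"
    then have "(Y * B_bar N h v) $$ (t, b) =
        (\<Sum>a<(N - 1) * 2. Y $$ (t, a) * B_bar N h v $$ (a, b))"
      using assms dims by (simp add: scalar_prod_def atLeast0LessThan)
    then show "(Y * B_bar N h v) $$ (t, b) * h u (b + 1) j =
        (\<Sum>i<N - 1. \<Sum>d<2. Y $$ (t, i * 2 + d) * B_bar N h v $$ (i * 2 + d, b) * h u (b + 1) j)"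
      by (simp only: sum_blocks sum_distrib_right)
  qed simp
  also have "\<dots> = (\<Sum>i<N - 1. \<Sum>d<2. \<Sum>b<N.
      Y $$ (t, i * 2 + d) * B_bar N h v $$ (i * 2 + d, b) * h u (b + 1) j)"
    \<comment> \<open>The first swap moves the antenna sum past \<open>i\<close>, the second past
      \<open>d\<close>.\<close>
    by (subst sum.swap) (intro sum.cong [OF refl] sum.swap)
  also have "\<dots> = (\<Sum>i<N - 1. \<Sum>d<2. Y $$ (t, i * 2 + d) * coupling N h v u (i + 1) (d + 1) j)"
  proof (intro sum.cong refl)
    fix i d :: nat assume "i \<in> {..<N - 1}" "d \<in> {..<2}"
    then have id: "i < N - 1" "d < 2" by auto
    have "(\<Sum>b<N. B_bar N h v $$ (i * 2 + d, b) * h u (b + 1) j) =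
      (\<Sum>b<N. (if b = i then inv_gain h v (i + 1) * cnj (h v (i + 1) (d + 1))
        else if b = N - 1 then - (inv_gain h v N * cnj (h v N (d + 1))) else 0) * h u (b + 1) j)"
      using id by (intro sum.cong refl) (simp only: index_B_bar lessThan_iff)
    also have "\<dots> = coupling N h v u (i + 1) (d + 1) j"
      using id by (subst sum_pivot_last) (simp_all add: coupling_def)
    finally show "(\<Sum>b<N. Y $$ (t, i * 2 + d) * B_bar N h v $$ (i * 2 + d, b) * h u (b + 1) j) =
        Y $$ (t, i * 2 + d) * coupling N h v u (i + 1) (d + 1) j"
      by (simp add: mult.assoc flip: sum_distrib_left)
  qed
  finally show ?thesis .
qed

text \<open>\<open>eff_a\<close> and \<open>eff_b\<close> are the first row of the Alamouti matrix
  that the receiver's combination makes of the coupling matrix.\<close>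

definition eff_a :: "nat \<Rightarrow> channel \<Rightarrow> nat \<Rightarrow> nat \<Rightarrow> nat \<Rightarrow> complex" where
  "eff_a N h v u i = coupling N h v u i 1 1 + cnj (coupling N h v u i 2 2)"

definition eff_b :: "nat \<Rightarrow> channel \<Rightarrow> nat \<Rightarrow> nat \<Rightarrow> nat \<Rightarrow> complex" where
  "eff_b N h v u i = coupling N h v u i 1 2 - cnj (coupling N h v u i 2 1)"

lemma cnj_inv_gain [simp]: "cnj (inv_gain h k i) = inv_gain h k i"
  by (simp add: inv_gain_def)

text \<open>In \<open>eff_a\<close> the two normalized squared norms give 1 - 1; in
  \<open>eff_b\<close> the off-diagonal entries cancel because the coupling matrix is
  Hermitian.\<close>

lemma eff_same_user:
  assumes "frob (h_row h u i) \<noteq> 0" "frob (h_row h u N) \<noteq> 0"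
  shows "eff_a N h u u i = 0" "eff_b N h u u i = 0"
  using inv_gain_mult[OF assms(1)] inv_gain_mult[OF assms(2)]
  by (simp_all add: eff_a_def eff_b_def coupling_def algebra_simps)

text \<open>The adjoint of one Alamouti block times another is the receiver's combination applied to
  \<open>cnj (h v i d) * h u i j\<close>. Hence the symbol separating precoder is built from the
  very numbers the receiver will see.\<close>

lemma index_B_tilde_H_tilde:
  assumes "i < N - 1" "c < 2" "d < 2"
  shows "(B_tilde N h v * H_tilde N h u) $$ (i * 2 + c, d) =
    alamouti (eff_a N h v u (i + 1)) (eff_b N h v u (i + 1)) $$ (c, d)"
proof -
  let ?B = "\<lambda>k e. inv_gain h v k * cnj (H_tilde_block h v k $$ (e, c))"
  have "(B_tilde N h v * H_tilde N h u) $$ (i * 2 + c, 0 * 2 + d) =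
    (\<Sum>b<N. \<Sum>e<2. (if b = i then ?B (i + 1) e else if b = N - 1 then - ?B N e else 0)
       * H_tilde_block h u (b + 1) $$ (e, d))"
    unfolding B_tilde_def H_tilde_def using assms
    by (subst index_block_mat_mult)
      (auto intro!: sum.cong simp: H_tilde_block_def index_mat_adjoint inv_gain_def)
  also have "\<dots> = (\<Sum>e<2. \<Sum>b<N.
      (if b = i then ?B (i + 1) e else if b = N - 1 then - ?B N e else 0)
       * H_tilde_block h u (b + 1) $$ (e, d))"
    by (rule sum.swap)
  also have "\<dots> = (\<Sum>e<2. ?B (i + 1) e * H_tilde_block h u (i + 1) $$ (e, d)
      - ?B N e * H_tilde_block h u N $$ (e, d))"
    using assms by (simp add: sum_pivot_last)
  also have "\<dots> = alamouti (eff_a N h v u (i + 1)) (eff_b N h v u (i + 1)) $$ (c, d)"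
    using assms(2,3)
    by (auto simp: lessThan_2 less_2_cases_iff H_tilde_block_def eff_a_def eff_b_def coupling_def
        algebra_simps)
  finally show ?thesis by simp
qed

section \<open>Precoded symbols\<close>

lemma dim_E_prec [simp]: "dim_row (E_prec N h u) = 2" "dim_col (E_prec N h u) = (N - 1) * 2"
  by (simp_all add: E_prec_def B_tilde_def H_tilde_def)

lemma dim_X_tilde [simp]:
  "dim_row (X_tilde N h s u) = 2" "dim_col (X_tilde N h s u) = (N - 1) * 2"
  by (simp_all add: X_tilde_def)

text \<open>Closure of Alamouti matrices under adjoint and product; the two arguments are the first
  row of the symbol matrix times the adjoint of \<open>alamouti a b\<close>.\<close>

lemma index_X_tilde:
  fixes h :: channel and u :: nat
  assumes "i < N - 1" "t < 2" "d < 2"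
  defines "a \<equiv> eff_a N h (other u) u (i + 1)" and "b \<equiv> eff_b N h (other u) u (i + 1)"
  shows "X_tilde N h s u $$ (t, i * 2 + d) = complex_of_real (beta N h u) *
    alamouti (s u 1 * cnj a + s u 2 * cnj b) (s u 2 * a - s u 1 * b) $$ (t, d)"
proof -
  have lt: "i * 2 + d < (N - 1) * 2"
    using assms by (intro block_index_less)
  have E: "E_prec N h u $$ (c, i * 2 + d) = complex_of_real (beta N h u) * cnj (alamouti a b $$ (d, c))"
    if "c < 2" for c
  proof -
    have dims: "dim_row (B_tilde N h (other u) * H_tilde N h u) = (N - 1) * 2"
      "dim_col (B_tilde N h (other u) * H_tilde N h u) = 2"
      by (simp_all add: B_tilde_def H_tilde_def)
    show ?thesis
      using lt that assms dims
      \<comment> \<open>The product stays folded so that \<open>index_B_tilde_H_tilde\<close>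
        applies.\<close>
      by (simp add: E_prec_def index_mat_adjoint index_B_tilde_H_tilde del: index_mult_mat)
  qed
  have "X_tilde N h s u $$ (t, i * 2 + d) =
      (\<Sum>c<2. alamouti (s u 1) (s u 2) $$ (t, c) * E_prec N h u $$ (c, i * 2 + d))"
    using assms lt by (simp add: X_tilde_def scalar_prod_def atLeast0LessThan)
  also have "\<dots> = (\<Sum>c<2. alamouti (s u 1) (s u 2) $$ (t, c) *
      (complex_of_real (beta N h u) * cnj (alamouti a b $$ (d, c))))"
    by (intro sum.cong refl) (simp only: E lessThan_iff)
  finally show ?thesis
    using assms(2,3) by (auto simp: lessThan_2 less_2_cases_iff algebra_simps)
qed

section \<open>The two users' streams at a receiver\<close>

definition stream :: "nat \<Rightarrow> channel \<Rightarrow> symbols \<Rightarrow> nat \<Rightarrow> nat \<Rightarrow> nat \<Rightarrow> nat \<Rightarrow> complex" where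
  "stream N h s u k t j =
    (\<Sum>b<N. (X_tilde N h s u * B_bar N h (other u)) $$ (t, b) * h k (b + 1) j)"

text \<open>\<open>X_sent\<close> is symmetric in the users, so the own stream can come first for
  either \<open>k\<close>. Slots of \<open>stream\<close> count from 0, hence
  \<open>t - 1\<close>.\<close>

lemma received_eq:
  assumes "t \<in> {1, 2}" "k \<in> {1, 2}"
  shows "received N P h s w k t j = complex_of_real (sqrt (P / 2)) *
    (stream N h s k k (t - 1) j + stream N h s (other k) k (t - 1) j) + w k t j"
proof -
  have [simp]: "dim_row (B_bar N h u) = (N - 1) * 2" "dim_col (B_bar N h u) = N" for u
    by (simp_all add: B_bar_def)
  let ?Z = "\<lambda>u. X_tilde N h s u * B_bar N h (other u)"
  have X: "X_sent N P h s $$ (t - 1, b) =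
      complex_of_real (sqrt (P / 2)) * (?Z k $$ (t - 1, b) + ?Z (other k) $$ (t - 1, b))"
    if "b < N" for b
    using assms that by (auto simp: X_sent_def other_def numeral_2_eq_2 algebra_simps)
  have "(\<Sum>i = 1..N. X_sent N P h s $$ (t - 1, i - 1) * h k i j) =
      (\<Sum>b<N. X_sent N P h s $$ (t - 1, b) * h k (b + 1) j)"
    using sum.shift_bounds_Suc_ivl
      [of "\<lambda>i. X_sent N P h s $$ (t - 1, i - 1) * h k i j" 0 N]
    by (simp add: atLeast0LessThan atLeastLessThanSuc_atLeastAtMost)
  also have "\<dots> = (\<Sum>b<N. complex_of_real (sqrt (P / 2)) *
      (?Z k $$ (t - 1, b) + ?Z (other k) $$ (t - 1, b)) * h k (b + 1) j)"
    by (intro sum.cong refl) (simp only: X lessThan_iff)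
  finally show ?thesis
    by (simp add: received_def stream_def algebra_simps sum_distrib_left sum.distrib
        del: index_mult_mat)
qed

text \<open>The second row of \<open>S\<close> is determined by conjugates of the first, so
  conjugating the second slot leaves only first-row entries, and their coefficients group into
  \<open>eff_a\<close> and \<open>eff_b\<close>.\<close>

lemma stream_combined:
  fixes N :: nat and h :: channel and s :: symbols
  defines "S \<equiv> \<lambda>u i. alamouti
      (s u 1 * cnj (eff_a N h (other u) u i) + s u 2 * cnj (eff_b N h (other u) u i))
      (s u 2 * eff_a N h (other u) u i - s u 1 * eff_b N h (other u) u i)"
  shows "stream N h s u k 0 1 + cnj (stream N h s u k 1 2) = complex_of_real (beta N h u) *
      (\<Sum>i<N - 1. S u (i + 1) $$ (0, 0) * eff_a N h (other u) k (i + 1)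
        - S u (i + 1) $$ (0, 1) * cnj (eff_b N h (other u) k (i + 1)))" (is ?first)
    and "stream N h s u k 0 2 - cnj (stream N h s u k 1 1) = complex_of_real (beta N h u) *
      (\<Sum>i<N - 1. S u (i + 1) $$ (0, 0) * eff_b N h (other u) k (i + 1)
        + S u (i + 1) $$ (0, 1) * cnj (eff_a N h (other u) k (i + 1)))" (is ?second)
proof -
  have stream: "stream N h s u k t j =
      (\<Sum>i<N - 1. \<Sum>d<2. complex_of_real (beta N h u) * S u (i + 1) $$ (t, d)
        * coupling N h (other u) k (i + 1) (d + 1) j)" if "t < 2" for t j
  proof -
    have "stream N h s u k t j = (\<Sum>i<N - 1. \<Sum>d<2. X_tilde N h s u $$ (t, i * 2 + d)
        * coupling N h (other u) k (i + 1) (d + 1) j)"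
      unfolding stream_def using that by (intro sum_mult_B_bar) (simp_all add: B_bar_def)
    also have "\<dots> = (\<Sum>i<N - 1. \<Sum>d<2. complex_of_real (beta N h u) * S u (i + 1) $$ (t, d)
        * coupling N h (other u) k (i + 1) (d + 1) j)"
      unfolding S_def using that by (intro sum.cong refl) (simp only: index_X_tilde lessThan_iff)
    finally show ?thesis .
  qed
  show ?first ?second
    by (simp_all add: stream S_def lessThan_2 sum_distrib_left eff_a_def [of N h "other u" k]
        eff_b_def [of N h "other u" k] numeral_2_eq_2 algebra_simps
        flip: sum.distrib sum_subtractf)
qed

definition gain :: "nat \<Rightarrow> channel \<Rightarrow> nat \<Rightarrow> complex" where
  "gain N h k = complex_of_real (beta N h k) * (\<Sum>i<N - 1.
     eff_a N h (other k) k (i + 1) * cnj (eff_a N h (other k) k (i + 1))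
     + eff_b N h (other k) k (i + 1) * cnj (eff_b N h (other k) k (i + 1)))"

text \<open>Transmit and receive coefficients coincide here, so the cross terms in the other symbol
  cancel and squared moduli remain.\<close>

lemma stream_own:
  "stream N h s k k 0 1 + cnj (stream N h s k k 1 2) = gain N h k * s k 1"
  "stream N h s k k 0 2 - cnj (stream N h s k k 1 1) = gain N h k * s k 2"
  unfolding stream_combined gain_def mult.assoc sum_distrib_right
  by (rule arg_cong [where f = "(*) _"], rule sum.cong [OF refl], simp add: algebra_simps)+

text \<open>The interferer is precoded with \<open>B_bar\<close> of user \<open>k\<close> itself, so
  every block meets the vanishing coefficients of \<open>eff_same_user\<close>.\<close>

lemma stream_other:
  assumes "admissible_channel N h" "k \<in> {1, 2}" "N \<ge> 1"
  shows "stream N h s (other k) k 0 1 + cnj (stream N h s (other k) k 1 2) = 0"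
    and "stream N h s (other k) k 0 2 - cnj (stream N h s (other k) k 1 1) = 0"
proof -
  have "other (other k) = k"
    using assms(2) by (auto simp: other_def)
  moreover have "eff_a N h k k (i + 1) = 0" "eff_b N h k k (i + 1) = 0" if "i < N - 1" for i
    using assms that by (auto simp: admissible_channel_def intro!: eff_same_user)
  ultimately show "stream N h s (other k) k 0 1 + cnj (stream N h s (other k) k 1 2) = 0"
    and "stream N h s (other k) k 0 2 - cnj (stream N h s (other k) k 1 1) = 0"
    by (simp_all add: stream_combined del: One_nat_def)
qed

text \<open>The combinations are additive and commute with the real power factor, so they act on
  streams and noise separately.\<close>

lemma r_bar_eq:
  assumes "admissible_channel N h" "k \<in> {1, 2}" "l \<in> {1, 2}" "N \<ge> 1"
  shows "r_bar N P h s w k l = complex_of_real (sqrt (P / 2)) * gain N h k * s k l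
    + (if l = 1 then w k 1 1 + cnj (w k 2 2) else w k 1 2 - cnj (w k 2 1))"
proof -
  let ?c = "complex_of_real (sqrt (P / 2))"
  let ?S = "\<lambda>t j. stream N h s k k t j + stream N h s (other k) k t j"
  have S1: "?S 0 1 + cnj (?S 1 2) = gain N h k * s k 1"
    using arg_cong2 [OF stream_own(1) [of N h s k] stream_other(1) [OF assms(1,2,4), of s],
        where f = "(+)"]
    by (simp add: algebra_simps)
  have S2: "?S 0 2 - cnj (?S 1 1) = gain N h k * s k 2"
    using arg_cong2 [OF stream_own(2) [of N h s k] stream_other(2) [OF assms(1,2,4), of s],
        where f = "(+)"]
    by (simp add: algebra_simps)
  have recv: "received N P h s w k 1 j = ?c * ?S 0 j + w k 1 j"
    "received N P h s w k 2 j = ?c * ?S 1 j + w k 2 j" for j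
    using received_eq [of 1] received_eq [of 2] assms(2) by simp_all
  have "received N P h s w k 1 1 + cnj (received N P h s w k 2 2) =
      ?c * (?S 0 1 + cnj (?S 1 2)) + (w k 1 1 + cnj (w k 2 2))"
    "received N P h s w k 1 2 - cnj (received N P h s w k 2 1) =
      ?c * (?S 0 2 - cnj (?S 1 1)) + (w k 1 2 - cnj (w k 2 1))"
    unfolding recv by (simp_all add: algebra_simps)
  then show ?thesis
    using assms(3) unfolding S1 S2 by (auto simp: r_bar_def)
qed

theorem proposition2:
  fixes N :: nat and P :: real and h :: channel and k :: nat
  assumes "N \<ge> 2"
    and "P > 0"
    and "admissible_channel N h"
    and "k \<in> {1, 2}"
  shows "(\<forall>l\<in>{1, 2}. \<forall>(s :: symbols) (s' :: symbols) (w :: noise).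
            s k 1 = s' k 1 \<and> s k 2 = s' k 2 \<longrightarrow>
            r_bar N P h s w k l = r_bar N P h s' w k l) \<and>
         (\<forall>l\<in>{1, 2}. \<exists>\<gamma> :: complex. \<forall>s :: symbols.
            r_bar N P h s (\<lambda>_ _ _. 0) k l = \<gamma> * s k l)"
proof -
  have eq: "r_bar N P h s w k l = complex_of_real (sqrt (P / 2)) * gain N h k * s k l
      + (if l = 1 then w k 1 1 + cnj (w k 2 2) else w k 1 2 - cnj (w k 2 1))"
    if "l \<in> {1, 2}" for s w l
    using assms that by (intro r_bar_eq) auto
  \<comment> \<open>Symbols enter \<open>eq\<close> only through \<open>s k l\<close>, which gives
    the first claim; with zero noise the remaining factor is the witness for both
    \<open>l\<close>.\<close>
  show ?thesis
    by (auto simp: eq intro!: exI [of _ "complex_of_real (sqrt (P / 2)) * gain N h k"])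
qed

end
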